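(* Let $N\ge2$, let $H$ be a real Hilbert space, $X=H^N$, and let $\Gamma\subseteq X$ be a $c$-monotone set. Suppose that $\Gamma$ is the graph of a continuous mapping $T=(T_2,\ldots,T_N):H\to H^{N-1}$, i.e., $$\Gamma=\{(x,T_2x,\ldots,T_Nx)\mid x\in H\},$$ where for each $2\le i\le N$ the mapping $T_i:H\to H$ is continuous. Then $\Gamma$ is maximally $c$-monotone.
   Context: $H$ is a real Hilbert space with inner product $\langle\cdot,\cdot\rangle$; $X=X_1\times\cdots\times X_N$ with every $X_i=H$. The cost function is $c:X\to\mathbb{R}$, $c(x_1,\dots,x_N)=\sum_{1\le i<j\le N}\langle x_i,x_j\rangle$. A set $\Gamma\subseteq X$ is $n$-$c$-monotone if for all $n$ tuples $(x_1^1,\dots,x_N^1),\dots,(x_1^n,\dots,x_N^n)$ in $\Gamma$ and all $N$ permutations $\sigma_1,\dots,\sigma_N\in S_n$, $\sum_{j=1}^n c(x_1^{\sigma_1(j)},\dots,x_N^{\sigma_N(j)})\le\sum_{j=1}^n c(x_1^j,\dots,x_N^j)$. $\Gamma$ is $c$-monotone if it is $2$-$c$-monotone, and maximally $c$-monotone if it is $c$-monotone and has no proper $c$-monotone extension in $X$. *)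

theory Defs
  imports "HOL-Analysis.Analysis"
begin

text \<open>
  The space \<open>X = H\<^sup>N\<close> is rendered as the set of functions on \<open>{1..N}\<close> that are
  \<open>undefined\<close> outside \<open>{1..N}\<close>, so that equality in \<open>X\<close> is equality of all \<open>N\<close>
  components.
\<close>

definition tuples :: "nat \<Rightarrow> (nat \<Rightarrow> 'a) set" where
  "tuples N = (\<Pi>\<^sub>E i\<in>{1..N}. UNIV)"

definition cost :: "nat \<Rightarrow> (nat \<Rightarrow> 'a::real_inner) \<Rightarrow> real" where
  "cost N x = (\<Sum>(i, j)\<in>{(i, j). 1 \<le> i \<and> i < j \<and> j \<le> N}. inner (x i) (x j))"

text \<open>
  Below, \<open>x j\<close> is the \<open>j\<close>-th of the \<open>n\<close> points and \<open>x j i\<close> its \<open>i\<close>-th component.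
  The points need not be distinct.
\<close>

definition n_c_monotone :: "nat \<Rightarrow> nat \<Rightarrow> (nat \<Rightarrow> 'a::real_inner) set \<Rightarrow> bool" where
  "n_c_monotone N n \<Gamma> \<longleftrightarrow>
     \<Gamma> \<subseteq> tuples N \<and>
     (\<forall>x \<sigma>. (\<forall>j\<in>{1..n}. x j \<in> \<Gamma>) \<and> (\<forall>i\<in>{1..N}. \<sigma> i permutes {1..n}) \<longrightarrow>
        (\<Sum>j=1..n. cost N (\<lambda>i\<in>{1..N}. x (\<sigma> i j) i)) \<le> (\<Sum>j=1..n. cost N (x j)))"

definition c_monotone :: "nat \<Rightarrow> (nat \<Rightarrow> 'a::real_inner) set \<Rightarrow> bool" where
  "c_monotone N \<Gamma> \<longleftrightarrow> n_c_monotone N 2 \<Gamma>"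

definition maximally_c_monotone :: "nat \<Rightarrow> (nat \<Rightarrow> 'a::real_inner) set \<Rightarrow> bool" where
  "maximally_c_monotone N \<Gamma> \<longleftrightarrow>
     c_monotone N \<Gamma> \<and> \<not> (\<exists>\<Delta>. \<Gamma> \<subset> \<Delta> \<and> c_monotone N \<Delta>)"

text \<open>Only the components \<open>T 2, \<dots>, T N\<close> of \<open>T\<close> are used.\<close>

definition graph_tuple :: "nat \<Rightarrow> (nat \<Rightarrow> 'a \<Rightarrow> 'a) \<Rightarrow> (nat \<Rightarrow> 'a) set" where
  "graph_tuple N T = {(\<lambda>i\<in>{1..N}. if i = 1 then x else T i x) | x. True}"

end

theory Submission
  imports Defs
begin

text \<open>
  Exchanging the \<open>k\<close>-th components of two points \<open>p, q\<close> of a \<open>c\<close>-monotone set changes the total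
  cost by an inner product, so that
  \<open>\<langle>p\<^sub>k - q\<^sub>k, \<Sum>\<^bsub>i\<noteq>k\<^esub> (p\<^sub>i - q\<^sub>i)\<rangle> \<ge> 0\<close>
  (\<open>c_monotone_single_swap\<close>). Let \<open>z\<close> be a point such that the graph of \<open>T\<close> together with \<open>z\<close> is
  \<open>c\<close>-monotone.

  For \<open>k = 1\<close> the inequality compares \<open>z\<close> with every point of the graph and says that
  \<open>\<langle>x - z\<^sub>1, F x\<rangle> \<ge> 0\<close> for all \<open>x \<in> H\<close>, where \<open>F x = \<Sum>\<^bsub>i\<ge>2\<^esub> (T\<^sub>i x - z\<^sub>i)\<close>. Letting \<open>x\<close> tend to
  \<open>z\<^sub>1\<close> along rays, continuity of \<open>F\<close> forces \<open>F z\<^sub>1 = 0\<close>, exactly as in the classical proof (Minty's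
  argument) that a continuous monotone operator is maximally monotone
  (\<open>continuous_variational_inequality_zero\<close>).

  Now compare \<open>z\<close> with the graph point over \<open>x = z\<^sub>1\<close>. The differences \<open>e\<^sub>i = T\<^sub>i z\<^sub>1 - z\<^sub>i\<close>
  (with \<open>e\<^sub>1 = 0\<close>) add up to \<open>0\<close>, so the sum of all but \<open>e\<^sub>k\<close> is \<open>- e\<^sub>k\<close> and the inequality for \<open>k\<close>
  reads \<open>- \<parallel>e\<^sub>k\<parallel>\<^sup>2 \<ge> 0\<close>. Hence every \<open>e\<^sub>k\<close> vanishes and \<open>z\<close> lies on the graph.
\<close>

text \<open>
  Expanding the square of the sum gives a form of the cost without the ordering \<open>i < j\<close>, in which
  any single component can be separated from the others.
\<close>

lemma cost_polarization:
  fixes x :: "nat \<Rightarrow> 'a::real_inner"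
  shows "2 * cost N x =
    inner (\<Sum>i=1..N. x i) (\<Sum>i=1..N. x i) - (\<Sum>i=1..N. inner (x i) (x i))"
proof (induction N)
  case 0
  have "{(i, j). 1 \<le> i \<and> i < j \<and> j \<le> (0::nat)} = {}"
    by auto
  then show ?case
    by (simp only: cost_def) simp
next
  case (Suc N)
  let ?P = "\<lambda>N. {(i, j). 1 \<le> i \<and> i < j \<and> j \<le> (N::nat)}"
  let ?new = "(\<lambda>i. (i, Suc N)) ` {1..N}"
  have split: "?P (Suc N) = ?P N \<union> ?new"
    by (auto simp: image_iff)
  have fin: "finite (?P N)"
    by (rule finite_subset[of _ "{1..N} \<times> {1..N}"]) auto
  have "cost (Suc N) x = cost N x + (\<Sum>(i, j)\<in>?new. inner (x i) (x j))"
    unfolding cost_def split by (rule sum.union_disjoint) (use fin in auto)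
  also have "(\<Sum>(i, j)\<in>?new. inner (x i) (x j)) = (\<Sum>i=1..N. inner (x i) (x (Suc N)))"
    by (subst sum.reindex) (auto simp: inj_on_def)
  also have "\<dots> = inner (\<Sum>i=1..N. x i) (x (Suc N))"
    by (simp add: inner_sum_left)
  finally have "2 * cost (Suc N) x = 2 * cost N x + 2 * inner (\<Sum>i=1..N. x i) (x (Suc N))"
    by simp
  then show ?case
    by (simp add: Suc.IH inner_add_left inner_add_right inner_commute)
qed

text \<open>
  In \<open>cost_polarization\<close> the squared norms of the components are only redistributed by the
  exchange, so only the two squared sums matter, and these differ by the mixed terms.
\<close>

lemma cost_single_swap:
  fixes p q :: "nat \<Rightarrow> 'a::real_inner"
  assumes k: "k \<in> {1..N}"
  shows "cost N p + cost N q
      - cost N (\<lambda>i\<in>{1..N}. if i = k then q i else p i)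
      - cost N (\<lambda>i\<in>{1..N}. if i = k then p i else q i)
    = inner (p k - q k) (\<Sum>i\<in>{1..N} - {k}. p i - q i)"
proof -
  let ?R = "{1..N} - {k}"
  have cost_split: "2 * cost N x =
      inner (x k + (\<Sum>i\<in>?R. x i)) (x k + (\<Sum>i\<in>?R. x i))
      - (inner (x k) (x k) + (\<Sum>i\<in>?R. inner (x i) (x i)))" for x :: "nat \<Rightarrow> 'a"
    unfolding cost_polarization sum.remove[OF finite_atLeastAtMost k] by (rule refl)
  have mixed: "2 * cost N (\<lambda>i\<in>{1..N}. if i = k then x i else y i) =
      inner (x k + (\<Sum>i\<in>?R. y i)) (x k + (\<Sum>i\<in>?R. y i))
      - (inner (x k) (x k) + (\<Sum>i\<in>?R. inner (y i) (y i)))" for x y :: "nat \<Rightarrow> 'a"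
    unfolding cost_split using k by simp
  show ?thesis
    using cost_split[of p] cost_split[of q] mixed[of p q] mixed[of q p]
    by (simp add: sum_subtractf inner_add_left inner_add_right inner_diff_left inner_diff_right
        inner_commute)
qed

lemma c_monotone_single_swap:
  fixes p q :: "nat \<Rightarrow> 'a::real_inner"
  assumes mono: "c_monotone N \<Gamma>" and p: "p \<in> \<Gamma>" and q: "q \<in> \<Gamma>" and k: "k \<in> {1..N}"
  shows "0 \<le> inner (p k - q k) (\<Sum>i\<in>{1..N} - {k}. p i - q i)"
proof -
  define x where "x j = (if j = 1 then p else q)" for j :: nat
  define \<sigma> :: "nat \<Rightarrow> nat \<Rightarrow> nat"
    where "\<sigma> i = (if i = k then Transposition.transpose 1 2 else id)" for i
  have two: "{1..2} = {1, 2::nat}"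
    by auto
  have "\<sigma> i permutes {1..2}" for i
    unfolding \<sigma>_def by (auto intro: permutes_swap_id simp: permutes_id)
  moreover have "x j \<in> \<Gamma>" for j
    using p q by (simp add: x_def)
  ultimately have "(\<Sum>j=1..2. cost N (\<lambda>i\<in>{1..N}. x (\<sigma> i j) i)) \<le> (\<Sum>j=1..2. cost N (x j))"
    using mono unfolding c_monotone_def n_c_monotone_def by blast
  moreover have "(\<lambda>i\<in>{1..N}. x (\<sigma> i 1) i) = (\<lambda>i\<in>{1..N}. if i = k then q i else p i)"
    and "(\<lambda>i\<in>{1..N}. x (\<sigma> i 2) i) = (\<lambda>i\<in>{1..N}. if i = k then p i else q i)"
    by (auto simp: x_def \<sigma>_def fun_eq_iff restrict_def)
  ultimately have "cost N (\<lambda>i\<in>{1..N}. if i = k then q i else p i)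
      + cost N (\<lambda>i\<in>{1..N}. if i = k then p i else q i) \<le> cost N p + cost N q"
    unfolding two by (simp add: x_def)
  then show ?thesis
    using cost_single_swap[OF k, of p q] by linarith
qed

text \<open>
  Approaching \<open>a\<close> from the direction \<open>- F a\<close>, the hypothesis passes to the limit
  \<open>\<langle>- F a, F a\<rangle> \<ge> 0\<close>.
\<close>

lemma continuous_variational_inequality_zero:
  fixes F :: "'a::real_inner \<Rightarrow> 'a"
  assumes cont: "isCont F a" and nonneg: "\<And>x. 0 \<le> inner (x - a) (F x)"
  shows "F a = 0"
proof -
  define h where "h = - F a"
  have "((\<lambda>t. a + t *\<^sub>R h) \<longlongrightarrow> a + 0 *\<^sub>R h) (at_right (0::real))"
    by (intro tendsto_intros)
  then have "((\<lambda>t. F (a + t *\<^sub>R h)) \<longlongrightarrow> F a) (at_right (0::real))"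
    using isCont_tendsto_compose[OF cont] by simp
  then have lim: "((\<lambda>t. inner h (F (a + t *\<^sub>R h))) \<longlongrightarrow> inner h (F a)) (at_right (0::real))"
    by (intro tendsto_intros)
  have "0 \<le> inner h (F (a + t *\<^sub>R h))" if "t > 0" for t :: real
    using nonneg[of "a + t *\<^sub>R h"] that by (simp add: zero_le_mult_iff)
  then have "eventually (\<lambda>t. 0 \<le> inner h (F (a + t *\<^sub>R h))) (at_right (0::real))"
    by (auto simp: eventually_at_filter)
  then have "0 \<le> inner h (F a)"
    using tendsto_lowerbound[OF lim] by simp
  then show ?thesis
    using inner_gt_zero_iff[of "F a"] unfolding h_def inner_minus_left by linarith
qed

lemma c_monotone_extension_of_continuous_graph:
  fixes T :: "nat \<Rightarrow> 'a::real_inner \<Rightarrow> 'a"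
  assumes N: "N \<ge> 1"
    and cont: "\<And>i. i \<in> {2..N} \<Longrightarrow> continuous_on UNIV (T i)"
    and mono: "c_monotone N \<Delta>"
    and graph: "graph_tuple N T \<subseteq> \<Delta>"
    and z: "z \<in> \<Delta>"
  shows "z \<in> graph_tuple N T"
proof -
  define g where "g x = (\<lambda>i\<in>{1..N}. if i = 1 then x else T i x)" for x
  have g: "g x \<in> \<Delta>" for x
    using graph unfolding g_def graph_tuple_def by blast
  have g_1: "g x 1 = x" for x
    using N by (simp add: g_def)
  have g_T: "g x i = T i x" if "i \<in> {2..N}" for x i
    using that by (simp add: g_def)
  have rest: "{1..N} - {1} = {2..N}"
    by auto
  define F where "F x = (\<Sum>i=2..N. T i x - z i)" for x
  have "isCont (T i) a" if "i \<in> {2..N}" for i a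
    using cont[OF that] by (simp add: continuous_on_eq_continuous_at)
  then have "isCont F (z 1)"
    unfolding F_def by (intro continuous_intros) auto
  moreover have "0 \<le> inner (x - z 1) (F x)" for x
    using c_monotone_single_swap[OF mono g[of x] z, of 1] N
    by (simp add: rest F_def g_1 g_T del: One_nat_def)
  ultimately have F_0: "F (z 1) = 0"
    by (rule continuous_variational_inequality_zero)
  define e where "e i = g (z 1) i - z i" for i
  have e_1: "e 1 = 0"
    by (simp only: e_def g_1) simp
  have "(\<Sum>i\<in>{1..N}. e i) = e 1 + (\<Sum>i\<in>{1..N} - {1}. e i)"
    using N by (intro sum.remove) auto
  also have "\<dots> = F (z 1)"
    unfolding e_1 rest by (simp add: F_def e_def g_T)
  finally have sum_e: "(\<Sum>i\<in>{1..N}. e i) = 0"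
    using F_0 by simp
  have agree: "g (z 1) k = z k" if k: "k \<in> {1..N}" for k
  proof -
    have "(\<Sum>i\<in>{1..N} - {k}. e i) = - e k"
      using sum_e sum.remove[OF _ k, of e] by (simp add: eq_neg_iff_add_eq_0 add.commute)
    then have "0 \<le> inner (e k) (- e k)"
      using c_monotone_single_swap[OF mono g[of "z 1"] z k] by (simp add: e_def)
    then have "e k = 0"
      using inner_gt_zero_iff[of "e k"] unfolding inner_minus_right by linarith
    then show ?thesis
      by (simp add: e_def)
  qed
  have "z \<in> tuples N"
    using mono z by (auto simp: c_monotone_def n_c_monotone_def)
  then have "z \<in> extensional {1..N}" and "g (z 1) \<in> extensional {1..N}"
    by (auto simp: tuples_def PiE_def g_def)
  then have "z = g (z 1)"
    by (rule extensionalityI) (rule agree[symmetric])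
  then show ?thesis
    unfolding graph_tuple_def g_def by blast
qed

theorem theorem3p1:
  fixes N :: nat
    and \<Gamma> :: "(nat \<Rightarrow> 'a::{real_inner, complete_space}) set"
    and T :: "nat \<Rightarrow> 'a \<Rightarrow> 'a"
  assumes "N \<ge> 2"
    and "c_monotone N \<Gamma>"
    and "\<And>i. i \<in> {2..N} \<Longrightarrow> continuous_on UNIV (T i)"
    and "\<Gamma> = graph_tuple N T"
  shows "maximally_c_monotone N \<Gamma>"
proof -
  have "\<Delta> \<subseteq> \<Gamma>" if "\<Gamma> \<subset> \<Delta>" "c_monotone N \<Delta>" for \<Delta>
    using c_monotone_extension_of_continuous_graph[of N T \<Delta>] assms that by auto
  then show ?thesis
    using assms(2) unfolding maximally_c_monotone_def by blast
qed

end
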